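(* (1) Let $\{a_k\}_{k=1}^\infty$ be a sequence of positive real numbers satisfying $$a_{2j-1}\ \ge\ \frac{2j}{2j-1}\,a_{2j}\qquad\text{and}\qquad a_{2j}\ \ge\ \frac{(2j+1)(4j-1)}{2j(4j+3)}\,a_{2j+1}\qquad (j=1,2,3,\dots).$$ Then $\sum a_k\sin(kx)$ is a PS in $[0,\pi]$, i.e. $\sum_{k=1}^n a_k\sin(kx)\ge 0$ for all $x\in[0,\pi]$ and all integers $n\ge 1$. (2) The maximal sum is $\sum\delta_k\sin(kx)$, where $\delta_k=2-\frac{(-1)^k}{k}$; that is, $\{\delta_k\}$ satisfies the conditions in (1), and $\{\delta_k\}\succeq\{a_k\}$ for every sequence $\{a_k\}$ of positive real numbers satisfying the conditions in (1).
   Context: A sum is called a PS (P-Sum) on an interval if all its partial sums are nonnegative on that interval. For sequences of positive real numbers, $\{a_k\}\succeq\{b_k\}$ means that the sequence $b_k/a_k$ is non-increasing in $k$; sequences differing by a non-zero multiple are regarded as equivalent. A sequence is called maximal for a set of conditions if it satisfies the conditions and is $\succeq$ every sequence satisfying them. *)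

theory Defs
  imports Complex_Main
begin

text \<open>Sequences \<open>a\<^sub>1, a\<^sub>2, \<dots>\<close> are functions on \<^typ>\<open>nat\<close> whose value at index 0 is
  irrelevant: every definition below only refers to indices \<open>k \<ge> 1\<close>.\<close>

definition PS_on :: "real set \<Rightarrow> (nat \<Rightarrow> real \<Rightarrow> real) \<Rightarrow> bool" where
  "PS_on S f \<longleftrightarrow> (\<forall>n\<ge>1. \<forall>x\<in>S. (\<Sum>k=1..n. f k x) \<ge> 0)"

definition pos_seq :: "(nat \<Rightarrow> real) \<Rightarrow> bool" where
  "pos_seq a \<longleftrightarrow> (\<forall>k\<ge>1. a k > 0)"

text \<open>The relation is meant for positive sequences only; otherwise the quotient is meaningless.\<close>

definition seq_dominates :: "(nat \<Rightarrow> real) \<Rightarrow> (nat \<Rightarrow> real) \<Rightarrow> bool"  (infix "\<succeq>" 50) where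
  "a \<succeq> b \<longleftrightarrow> antimono_on {1..} (\<lambda>k. b k / a k)"

text \<open>``Maximal'' means greatest with respect to \<open>\<succeq>\<close>, among the positive sequences satisfying
  the conditions \<open>C\<close>.\<close>

definition maximal_seq :: "((nat \<Rightarrow> real) \<Rightarrow> bool) \<Rightarrow> (nat \<Rightarrow> real) \<Rightarrow> bool" where
  "maximal_seq C a \<longleftrightarrow> pos_seq a \<and> C a \<and> (\<forall>b. pos_seq b \<and> C b \<longrightarrow> a \<succeq> b)"

definition sine_conditions :: "(nat \<Rightarrow> real) \<Rightarrow> bool" where
  "sine_conditions a \<longleftrightarrow> (\<forall>j\<ge>1.
     a (2 * j - 1) \<ge> (2 * real j) / (2 * real j - 1) * a (2 * j) \<and>
     a (2 * j) \<ge> ((2 * real j + 1) * (4 * real j - 1)) / (2 * real j * (4 * real j + 3))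
                  * a (2 * j + 1))"

definition delta :: "nat \<Rightarrow> real" where
  "delta k = 2 - (- 1) ^ k / real k"

end

theory Submission
  imports Defs "HOL-Analysis.Complex_Transcendental"
begin

text \<open>The sequence \<open>\<delta>\<close> turns every condition into an equality: the two lower bounds for the ratios
  \<open>a\<^sub>k / a\<^sub>k\<^sub>+\<^sub>1\<close> are exactly \<open>\<delta>\<^sub>k / \<delta>\<^sub>k\<^sub>+\<^sub>1\<close>. Hence a positive sequence satisfies the conditions
  precisely when \<open>a\<^sub>k / \<delta>\<^sub>k\<close> is non-increasing, which is maximality of \<open>\<delta>\<close>
  (\<open>antimono_on_quotient_delta\<close>); summation by parts (\<open>weighted_sum_ge\<close>) then reduces the first
  part to the single series \<open>\<Sum> \<delta>\<^sub>k sin kx\<close>.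

  Write \<open>y = \<pi> - x\<close>, \<open>v = x/2\<close> and \<open>N = n + 1/2\<close>. There are two regimes.

  If \<open>n y \<le> \<pi>\<close> (\<open>delta_sum_nonneg_near_pi\<close>), the terms of index \<open>2j-1\<close> and \<open>2j\<close> add up to
  \<open>4j-1\<close> times \<open>sin((2j-1)y)/(2j-1) - sin(2jy)/(2j)\<close>, which is nonnegative because
  \<open>sin t / t\<close> decreases on \<open>(0,\<pi>]\<close>. If one term is left over, it is a positive multiple of
  \<open>sin(ny)\<close> with \<open>n\<close> odd.

  If \<open>N y \<ge> \<pi>\<close> (\<open>delta_sum_nonneg_bulk\<close>), split \<open>\<delta>\<^sub>k = 2 - (-1)\<^sup>k/k\<close>. The first summand gives the
  conjugate Dirichlet kernel \<open>(cos v - cos Nx) / sin v = - tan(v/2) + (1 - cos Nx) / sin v\<close>.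
  The second gives the Fejer-Jackson sum at \<open>y\<close>, which is \<open>v\<close> up to an
  oscillating error of size \<open>\<bar>sin Nx\<bar> / (2N cos v)\<close> and a remainder of at most
  \<open>(1 / cos v - 1) / (2N)\<close> (\<open>alternating_sine_sum_ge\<close>). The two oscillations are in quadrature: where the kernel is
  lowest, \<open>cos Nx = 1\<close>, the error in the other sum vanishes. Quantitatively
  \<open>1 - cos Nx \<ge> (sin Nx)\<^sup>2 / 2\<close>, so completing the square in \<open>\<bar>sin Nx\<bar>\<close> turns the oscillating error into one of
  second order in \<open>1/N\<close>. What remains is an elementary inequality
  between \<open>v - tan(v/2)\<close> and the errors (\<open>margin_beats_error\<close>).\<close>

section \<open>Reduction to the maximal sequence\<close>

lemma delta_odd: "j \<ge> 1 \<Longrightarrow> delta (2 * j - 1) = (4 * real j - 1) / (2 * real j - 1)"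
  by (simp add: delta_def of_nat_diff field_simps)

lemma delta_even: "j \<ge> 1 \<Longrightarrow> delta (2 * j) = (4 * real j - 1) / (2 * real j)"
  by (simp add: delta_def field_simps)

lemma delta_odd_Suc: "delta (2 * j + 1) = (4 * real j + 3) / (2 * real j + 1)"
  by (simp add: delta_def field_simps)

lemma pos_seq_delta: "pos_seq delta"
proof -
  have "delta k > 0" if "k \<ge> 1" for k
  proof -
    have "(- 1) ^ k \<le> real k"
      using that by (cases "even k") auto
    then have "(- 1) ^ k / real k \<le> 1"
      using that by simp
    then show ?thesis by (simp add: delta_def)
  qed
  then show ?thesis by (simp add: pos_seq_def)
qed

text \<open>Both conditions hold with equality.\<close>

lemma sine_conditions_delta: "sine_conditions delta"
  unfolding sine_conditions_def
proof (intro allI impI)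
  fix j :: nat
  assume j: "1 \<le> j"
  define r where "r = real j"
  have r: "r \<ge> 1" using j by (simp add: r_def)
  have "(2 * r) / (2 * r - 1) * ((4 * r - 1) / (2 * r)) = (4 * r - 1) / (2 * r - 1)"
    using r by simp
  moreover have "((2 * r + 1) * (4 * r - 1)) / (2 * r * (4 * r + 3))
      * ((4 * r + 3) / (2 * r + 1)) = (4 * r - 1) / (2 * r)"
    using r by (simp add: divide_simps)
  ultimately show "(2 * real j) / (2 * real j - 1) * delta (2 * j) \<le> delta (2 * j - 1) \<and>
     ((2 * real j + 1) * (4 * real j - 1)) / (2 * real j * (4 * real j + 3))
        * delta (2 * j + 1) \<le> delta (2 * j)"
    unfolding delta_odd[OF j] delta_even[OF j] delta_odd_Suc r_def by simp
qed

text \<open>Dividing each condition by the corresponding equality for \<^const>\<open>delta\<close> gives one step of the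
  monotonicity, the first condition from odd to even indices and the second from even to odd ones.\<close>

lemma antimono_on_quotient_delta:
  assumes pos: "pos_seq a" and cond: "sine_conditions a"
  shows "antimono_on {1..} (\<lambda>k. a k / delta k)"
proof -
  have step: "a (Suc k) / delta (Suc k) \<le> a k / delta k" if k: "k \<ge> 1" for k
  proof (cases "even k")
    case True
    then obtain j where kj: "k = 2 * j" by (elim evenE)
    then have j: "j \<ge> 1" using k by simp
    define r where "r = real j"
    have r: "r \<ge> 1" using j by (simp add: r_def)
    have "a (2 * j) \<ge> ((2 * r + 1) * (4 * r - 1)) / (2 * r * (4 * r + 3)) * a (2 * j + 1)"
      using cond j unfolding sine_conditions_def r_def by blast
    then have "((2 * r + 1) * (4 * r - 1)) / (2 * r * (4 * r + 3)) * a (2 * j + 1)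
        / ((4 * r - 1) / (2 * r)) \<le> a (2 * j) / ((4 * r - 1) / (2 * r))"
      using r by (intro divide_right_mono) auto
    moreover have "((2 * r + 1) * (4 * r - 1)) / (2 * r * (4 * r + 3)) * a (2 * j + 1)
        / ((4 * r - 1) / (2 * r)) = a (2 * j + 1) / ((4 * r + 3) / (2 * r + 1))"
      using r by (simp add: divide_simps)
    ultimately have "a (2 * j + 1) / ((4 * r + 3) / (2 * r + 1)) \<le> a (2 * j) / ((4 * r - 1) / (2 * r))"
      by (simp only:)
    then show ?thesis
      using delta_even[OF j] delta_odd_Suc[of j] by (simp add: kj r_def)
  next
    case False
    then obtain i where ki: "k = 2 * i + 1" by (elim oddE)
    define j where "j = i + 1"
    have j: "j \<ge> 1" and kj: "k = 2 * j - 1" "Suc k = 2 * j" by (simp_all add: j_def ki)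
    define r where "r = real j"
    have r: "r \<ge> 1" using j by (simp add: r_def)
    have "a (2 * j - 1) \<ge> (2 * r) / (2 * r - 1) * a (2 * j)"
      using cond j unfolding sine_conditions_def r_def by blast
    then have "(2 * r) / (2 * r - 1) * a (2 * j) / ((4 * r - 1) / (2 * r - 1))
        \<le> a (2 * j - 1) / ((4 * r - 1) / (2 * r - 1))"
      using r by (intro divide_right_mono) auto
    moreover have "(2 * r) / (2 * r - 1) * a (2 * j) / ((4 * r - 1) / (2 * r - 1))
        = a (2 * j) / ((4 * r - 1) / (2 * r))"
      using r by (simp add: divide_simps)
    ultimately have "a (2 * j) / ((4 * r - 1) / (2 * r)) \<le> a (2 * j - 1) / ((4 * r - 1) / (2 * r - 1))"
      by (simp only:)
    then show ?thesis
      unfolding kj(2) unfolding kj(1) delta_even[OF j] delta_odd[OF j] r_def .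
  qed
  show ?thesis
  proof (rule monotone_onI)
    fix m n :: nat
    assume "m \<in> {1..}" "n \<in> {1..}" "m \<le> n"
    then show "a n / delta n \<le> a m / delta m"
      using lift_Suc_antimono_le_ivl[of "{1..}" "\<lambda>k. a k / delta k" m n] step
      by (simp add: subset_iff)
  qed
qed

text \<open>Summation by parts. Bounding the weighted sum by its boundary term, rather than by \<open>0\<close>, is
  what lets the induction go through.\<close>

lemma weighted_sum_ge:
  fixes b c :: "nat \<Rightarrow> real"
  assumes c: "antimono_on {1..} c"
    and b: "\<And>m. m \<ge> 1 \<Longrightarrow> (\<Sum>k=1..m. b k) \<ge> 0"
    and n: "n \<ge> 1"
  shows "(\<Sum>k=1..n. c k * b k) \<ge> c n * (\<Sum>k=1..n. b k)"
  using n
proof (induction n rule: dec_induct)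
  case base
  show ?case by simp
next
  case (step n)
  have "c (Suc n) \<le> c n"
    using monotone_onD[OF c, of n "Suc n"] step.hyps by simp
  then have "c (Suc n) * (\<Sum>k=1..n. b k) \<le> c n * (\<Sum>k=1..n. b k)"
    using b[of n] step.hyps by (intro mult_right_mono) auto
  then show ?case using step.IH by (simp add: distrib_left)
qed

section \<open>Closed forms of the trigonometric kernels\<close>

lemma sum_sin_closed_form:
  "2 * sin (x / 2) * (\<Sum>k=1..n. sin (real k * x)) = cos (x / 2) - cos ((real n + 1 / 2) * x)"
proof (induction n)
  case (Suc n)
  have "2 * sin (x / 2) * sin (real (Suc n) * x)
      = cos ((real n + 1 / 2) * x) - cos ((real (Suc n) + 1 / 2) * x)"
  proof -
    have "real (Suc n) * x - x / 2 = (real n + 1 / 2) * x"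
      and "real (Suc n) * x + x / 2 = (real (Suc n) + 1 / 2) * x"
      by (simp_all add: algebra_simps)
    then show ?thesis
      using cos_diff[of "real (Suc n) * x" "x / 2"] cos_add[of "real (Suc n) * x" "x / 2"] by simp
  qed
  then show ?case using Suc by (simp add: distrib_left)
qed simp

lemma alternating_sum_cos_closed_form:
  "2 * cos (x / 2) * (\<Sum>k=1..n. - ((- 1) ^ k) * cos (real k * x))
     = cos (x / 2) - (- 1) ^ n * cos ((real n + 1 / 2) * x)"
proof (induction n)
  case (Suc n)
  have e: "2 * cos (x / 2) * cos (real (Suc n) * x)
      = cos ((real n + 1 / 2) * x) + cos ((real (Suc n) + 1 / 2) * x)"
  proof -
    have "real (Suc n) * x - x / 2 = (real n + 1 / 2) * x"
      and "real (Suc n) * x + x / 2 = (real (Suc n) + 1 / 2) * x"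
      by (simp_all add: algebra_simps)
    then show ?thesis
      using cos_diff[of "real (Suc n) * x" "x / 2"] cos_add[of "real (Suc n) * x" "x / 2"] by simp
  qed
  have "2 * cos (x / 2) * (\<Sum>k=1..Suc n. - ((- 1) ^ k) * cos (real k * x))
    = 2 * cos (x / 2) * (\<Sum>k=1..n. - ((- 1) ^ k) * cos (real k * x))
      + (- 1) ^ n * (2 * cos (x / 2) * cos (real (Suc n) * x))"
    by (simp add: distrib_left)
  then show ?case unfolding Suc e by (simp add: distrib_left)
qed simp

section \<open>The alternating Fejer-Jackson sum\<close>

text \<open>By \<open>alternating_sum_cos_closed_form\<close> the sum has derivative
  \<open>1/2 - (-1)\<^sup>n cos(Nx) / (2 cos(x/2))\<close>, so it is \<open>x/2\<close> plus an oscillatory integral. One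
  integration by parts extracts the boundary term with \<open>sin(Nx)\<close>; the remaining integrand is
  \<open>sin(Nt) / (2N)\<close> times the nonnegative derivative of \<open>1 / cos(t/2)\<close>, so the remainder is at most
  \<open>(1 / cos(x/2) - 1) / (2N)\<close>. The proof phrases this as monotonicity of an auxiliary function.\<close>

lemma alternating_sine_sum_ge:
  fixes x :: real and n :: nat
  assumes x: "0 \<le> x" "x < pi"
  defines "N \<equiv> real n + 1 / 2"
  shows "(\<Sum>k=1..n. - ((- 1) ^ k) / real k * sin (real k * x))
     \<ge> x / 2 - \<bar>sin (N * x)\<bar> / (2 * N * cos (x / 2)) - (1 / cos (x / 2) - 1) / (2 * N)"
proof -
  define e :: real where "e = (- 1) ^ n"
  have e: "e * z \<le> \<bar>z\<bar>" "- (e * z) \<le> \<bar>z\<bar>" for z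
    by (cases "even n"; simp add: e_def)+
  have N: "N > 0" by (simp add: N_def)
  define F where "F = (\<lambda>t. \<Sum>k=1..n. - ((- 1) ^ k) / real k * sin (real k * t))"
  \<comment> \<open>The remainder after integration by parts plus its own bound: increasing as \<open>\<bar>e sin(Nt)\<bar> \<le> 1\<close>.\<close>
  define H where "H = (\<lambda>t. F t - t / 2 + e * sin (N * t) / (2 * N * cos (t / 2)) + 1 / (2 * N * cos (t / 2)))"
  have "\<exists>h. DERIV H t :> h \<and> h \<ge> 0" if t: "0 \<le> t" "t \<le> x" for t
  proof -
    have c: "cos (t / 2) > 0" using t x by (intro cos_gt_zero_pi) auto
    have s: "sin (t / 2) \<ge> 0" using t x by (intro sin_ge_zero) auto
    have dF: "DERIV F t :> (\<Sum>k=1..n. - ((- 1) ^ k) * cos (real k * t))"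
      unfolding F_def by (rule DERIV_sum) (auto intro!: derivative_eq_intros)
    have F': "(\<Sum>k=1..n. - ((- 1) ^ k) * cos (real k * t)) = 1 / 2 - e * cos (N * t) / (2 * cos (t / 2))"
      using alternating_sum_cos_closed_form[of t n] c unfolding N_def e_def
      by (simp add: field_simps)
    define h where "h = (1 + e * sin (N * t)) * sin (t / 2) / (4 * N * (cos (t / 2))\<^sup>2)"
    have "DERIV H t :> h"
      unfolding H_def h_def
      apply (rule derivative_eq_intros dF refl | use c N in force)+
      unfolding F' using c N by (simp add: field_simps power2_eq_square)
    moreover have "1 + e * sin (N * t) \<ge> 0"
      using e(2)[of "sin (N * t)"] abs_sin_le_one[of "N * t"] by linarith
    then have "h \<ge> 0" unfolding h_def using s c N by (intro divide_nonneg_pos mult_nonneg_nonneg) auto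
    ultimately show ?thesis by blast
  qed
  then have "H 0 \<le> H x" using x by (intro DERIV_nonneg_imp_nondecreasing[of 0 x H]) auto
  moreover have "H 0 = 1 / (2 * N)" by (simp add: H_def F_def)
  moreover have "cos (x / 2) > 0" using x by (intro cos_gt_zero_pi) auto
  then have "e * sin (N * x) / (2 * N * cos (x / 2)) \<le> \<bar>sin (N * x)\<bar> / (2 * N * cos (x / 2))"
    using e(1) N by (intro divide_right_mono) auto
  ultimately have "F x \<ge> x / 2 - \<bar>sin (N * x)\<bar> / (2 * N * cos (x / 2)) - 1 / (2 * N * cos (x / 2)) + 1 / (2 * N)"
    unfolding H_def by linarith
  then show ?thesis unfolding F_def using N by (simp add: diff_divide_distrib mult.commute)
qed

section \<open>Elementary inequalities\<close>

lemma mult_cos_le_sin: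
  fixes u :: real
  assumes "0 \<le> u" "u \<le> pi"
  shows "u * cos u \<le> sin u"
proof -
  have "\<exists>h. DERIV (\<lambda>t. sin t - t * cos t) t :> h \<and> h \<ge> 0" if "0 \<le> t" "t \<le> u" for t
    using that assms
    by (intro exI[of _ "t * sin t"] conjI)
      (auto intro!: derivative_eq_intros mult_nonneg_nonneg sin_ge_zero)
  from DERIV_nonneg_imp_nondecreasing[OF assms(1) this] show ?thesis by simp
qed

text \<open>Jordan's inequality: \<open>sin t / t\<close> decreases, and its value at \<open>\<pi>/2\<close> is \<open>2/\<pi>\<close>.\<close>

lemma sin_ge_chord:
  fixes u :: real
  assumes "0 \<le> u" "u \<le> pi / 2"
  shows "2 * u / pi \<le> sin u"
proof (cases "u = 0")
  case False
  then have u: "u > 0" using assms by simp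
  have "\<exists>h. DERIV (\<lambda>t. - (sin t / t)) t :> h \<and> h \<ge> 0" if t: "u \<le> t" "t \<le> pi / 2" for t
  proof -
    have "DERIV (\<lambda>t. - (sin t / t)) t :> (sin t - t * cos t) / t\<^sup>2"
      using t u by (auto intro!: derivative_eq_intros simp: field_simps power2_eq_square)
    then show ?thesis using mult_cos_le_sin[of t] t u by (intro exI conjI) auto
  qed
  from DERIV_nonneg_imp_nondecreasing[OF assms(2) this] show ?thesis
    using u by (simp add: field_simps)
qed simp

text \<open>Likewise \<open>tan t / t\<close> increases, and its value at \<open>\<pi>/4\<close> is \<open>4/\<pi>\<close>.\<close>

lemma tan_le_chord:
  fixes w :: real
  assumes "0 \<le> w" "w \<le> pi / 4"
  shows "tan w \<le> 4 * w / pi"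
proof (cases "w = 0")
  case False
  then have w: "w > 0" using assms by simp
  have "\<exists>h. DERIV (\<lambda>t. tan t / t) t :> h \<and> h \<ge> 0" if t: "w \<le> t" "t \<le> pi / 4" for t
  proof -
    have c: "cos t > 0" using t w by (intro cos_gt_zero_pi) auto
    have "DERIV (\<lambda>t. tan t / t) t :> (t * inverse ((cos t)\<^sup>2) - tan t) / t\<^sup>2"
      using t w c by (auto intro!: derivative_eq_intros simp: field_simps power2_eq_square)
    moreover have "sin t * cos t \<le> t"
    proof -
      have "sin (2 * t) \<le> 2 * t" using t w by (intro sin_x_le_x) auto
      then show ?thesis by (simp add: sin_double)
    qed
    then have "t * inverse ((cos t)\<^sup>2) - tan t \<ge> 0"
      using c by (simp add: tan_def field_simps power2_eq_square)
    ultimately show ?thesis by (intro exI conjI) auto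
  qed
  from DERIV_nonneg_imp_nondecreasing[OF assms(2) this] show ?thesis
    using w by (simp add: tan_45 field_simps)
qed simp

lemma sin_mult_tan_half:
  fixes v :: real
  assumes "cos (v / 2) \<noteq> 0"
  shows "sin v * tan (v / 2) = 1 - cos v"
  using assms sin_double[of "v / 2"] cos_double_sin[of "v / 2"]
  by (simp add: tan_def power2_eq_square)

text \<open>With \<open>u = \<pi>/2 - v\<close> the hypothesis reads \<open>1/N \<le> 2u/\<pi>\<close>. This compensates the poles of the error
  terms at \<open>v = \<pi>/2\<close>, and leaves bounds that are linear in \<open>v\<close>: the second term is at
  most \<open>v/8\<close>, by Jordan's inequality, and the third at most \<open>tan(v/2)/\<pi>\<close>, because
  \<open>1 / cos v - 1 = tan v tan(v/2)\<close> and \<open>u cot u \<le> 1\<close>. It remains to see that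
  \<open>(1 + 1/\<pi>) tan(v/2) \<le> 7v/8\<close>, where the chord bound for the tangent suffices.\<close>

lemma margin_beats_error:
  fixes v N :: real
  assumes v: "0 < v" "v < pi / 2" and N: "N * (pi - 2 * v) \<ge> pi"
  shows "tan (v / 2) + sin v / (8 * N\<^sup>2 * (cos v)\<^sup>2) + (1 / cos v - 1) / (2 * N) \<le> v"
proof -
  define u where "u = pi / 2 - v"
  have u: "0 < u" "u < pi / 2" using v by (auto simp: u_def)
  have cv: "cos v = sin u" and sv: "sin v = cos u"
    by (simp_all add: u_def sin_diff cos_diff)
  have su: "sin u > 0" using u by (intro sin_gt_zero) auto
  have Nu: "N * (2 * u) \<ge> pi" using N by (simp add: u_def algebra_simps)
  have Npos: "N > 0"
  proof (rule ccontr)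
    assume "\<not> N > 0"
    then have "N * (2 * u) \<le> 0" using u by (intro mult_nonpos_nonneg) auto
    then show False using Nu pi_gt_zero by linarith
  qed
  have invN: "1 / N \<le> 2 * u / pi" using Nu Npos by (simp add: field_simps)
  define t where "t = tan (v / 2)"
  have t0: "t \<ge> 0" unfolding t_def using v by (intro less_imp_le tan_gt_zero) auto
  have first: "(1 / cos v - 1) / (2 * N) \<le> t / pi"
  proof -
    have "cos (v / 2) > 0" using v by (intro cos_gt_zero_pi) auto
    then have "sin v * t = 1 - cos v" unfolding t_def by (intro sin_mult_tan_half) simp
    then have "1 / cos v - 1 = sin v / cos v * t"
      using su cv by (simp add: diff_divide_distrib)
    then have "(1 / cos v - 1) / (2 * N) = (1 / N) * (cos u / sin u * t / 2)"
      by (simp add: cv sv)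
    also have "\<dots> \<le> (2 * u / pi) * (cos u / sin u * t / 2)"
      using invN su t0 u by (intro mult_right_mono mult_nonneg_nonneg divide_nonneg_pos cos_ge_zero) auto
    also have "\<dots> = (u * cos u / sin u) * (t / pi)" by (simp add: mult_ac)
    also have "\<dots> \<le> 1 * (t / pi)"
      using mult_cos_le_sin[of u] u su t0 by (intro mult_right_mono) auto
    finally show ?thesis by simp
  qed
  have second: "sin v / (8 * N\<^sup>2 * (cos v)\<^sup>2) \<le> v / 8"
  proof -
    have "1 / N \<le> sin u" using invN sin_ge_chord[of u] u by linarith
    then have "1 \<le> N * sin u" using Npos by (simp add: field_simps)
    then have "1 \<le> (N * sin u)\<^sup>2" by (simp add: one_le_power)
    then have "sin v / (8 * (N * sin u)\<^sup>2) \<le> sin v / (8 * 1)"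
      using v by (intro divide_left_mono sin_ge_zero) auto
    also have "\<dots> \<le> v / 8" using sin_x_le_x[of v] v by simp
    finally show ?thesis by (simp add: cv power_mult_distrib mult.assoc)
  qed
  have third: "t + t / pi \<le> 7 / 8 * v"
  proof -
    \<comment> \<open>The cruder bound \<open>\<pi> \<ge> 3\<close> would give \<open>8/9\<close>, which exceeds \<open>7/8\<close>.\<close>
    have pi: "pi \<ge> 31 / 10" using pi_approx by simp
    have "t * (1 + 1 / pi) \<le> (2 * v / pi) * (1 + 1 / pi)"
      unfolding t_def using tan_le_chord[of "v / 2"] v by (intro mult_right_mono) auto
    also have "\<dots> = (2 / pi * (1 + 1 / pi)) * v" by simp
    also have "\<dots> \<le> (2 / (31 / 10) * (1 + 1 / (31 / 10))) * v"
      using pi v by (intro mult_right_mono mult_mono add_mono divide_left_mono) auto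
    also have "\<dots> \<le> 7 / 8 * v" using v by (intro mult_right_mono) auto
    finally show ?thesis by (simp add: algebra_simps)
  qed
  show ?thesis using first second third unfolding t_def by linarith
qed

section \<open>Nonnegativity for the maximal sequence\<close>

text \<open>A discrete form of the decrease of \<open>sin t / t\<close> on \<open>(0,\<pi>]\<close>: both sides vanish at \<open>y = 0\<close>, and their
  derivatives compare because the cosine decreases on \<open>[0,\<pi>]\<close>.\<close>

lemma mult_sin_Suc_le:
  fixes y :: real
  assumes y: "0 \<le> y" "real (Suc k) * y \<le> pi"
  shows "real k * sin (real (Suc k) * y) \<le> real (Suc k) * sin (real k * y)"
proof -
  let ?f = "\<lambda>t. real (Suc k) * sin (real k * t) - real k * sin (real (Suc k) * t)"
  have "\<exists>h. DERIV ?f t :> h \<and> h \<ge> 0" if t: "0 \<le> t" "t \<le> y" for t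
  proof -
    have "real (Suc k) * t \<le> real (Suc k) * y" using t by (intro mult_left_mono) auto
    then have "real (Suc k) * t \<le> pi" using y by linarith
    then have "cos (real (Suc k) * t) \<le> cos (real k * t)"
      using t by (intro cos_monotone_0_pi_le) (auto intro: mult_right_mono)
    then have "real k * real (Suc k) * (cos (real k * t) - cos (real (Suc k) * t)) \<ge> 0" by simp
    moreover have "DERIV ?f t :> real k * real (Suc k) * (cos (real k * t) - cos (real (Suc k) * t))"
      by (auto intro!: derivative_eq_intros simp: algebra_simps)
    ultimately show ?thesis by blast
  qed
  from DERIV_nonneg_imp_nondecreasing[OF y(1) this] show ?thesis by simp
qed

lemma sin_mult_pi_minus: "sin (real k * (pi - y)) = - ((- 1) ^ k) * sin (real k * y)"
  by (simp add: right_diff_distrib sin_diff)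

text \<open>The pairing cancels the first order in \<open>y\<close>: for even \<open>n\<close> the sum vanishes to third order at
  \<open>x = \<pi>\<close>, so here the sum has to be treated exactly instead of being estimated.\<close>

lemma delta_sum_nonneg_near_pi:
  assumes y: "0 \<le> y" "real n * y \<le> pi"
  shows "(\<Sum>k=1..n. delta k * sin (real k * (pi - y))) \<ge> 0"
proof -
  let ?S = "\<lambda>n. \<Sum>k=1..n. delta k * sin (real k * (pi - y))"
  have even_case: "?S (2 * m) \<ge> 0" if "real (2 * m) * y \<le> pi" for m
    using that
  proof (induction m)
    case (Suc m)
    have le: "real (2 * m) * y \<le> real (2 * Suc m) * y" using y by (intro mult_right_mono) auto
    have "delta (2 * m + 1) * sin (real (2 * m + 1) * (pi - y))
          + delta (2 * m + 2) * sin (real (2 * m + 2) * (pi - y))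
        = (4 * real m + 3) * (sin (real (2 * m + 1) * y) / real (2 * m + 1)
             - sin (real (2 * m + 2) * y) / real (2 * m + 2))"
    proof -
      have "delta (2 * m + 1) = (4 * real m + 3) / real (2 * m + 1)"
        and "delta (2 * m + 2) = (4 * real m + 3) / real (2 * m + 2)"
        using delta_odd_Suc[of m] delta_even[of "m + 1"] by (simp_all add: algebra_simps)
      then show ?thesis unfolding sin_mult_pi_minus by (simp add: right_diff_distrib)
    qed
    moreover have "sin (real (2 * m + 2) * y) / real (2 * m + 2) \<le> sin (real (2 * m + 1) * y) / real (2 * m + 1)"
      using mult_sin_Suc_le[of y "2 * m + 1"] y Suc.prems by (simp add: field_simps)
    ultimately have "delta (2 * m + 1) * sin (real (2 * m + 1) * (pi - y))
          + delta (2 * m + 2) * sin (real (2 * m + 2) * (pi - y)) \<ge> 0" by simp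
    moreover have "?S (2 * m) \<ge> 0" using Suc le by linarith
    moreover have "?S (2 * Suc m) = ?S (2 * m) + (delta (2 * m + 1) * sin (real (2 * m + 1) * (pi - y))
          + delta (2 * m + 2) * sin (real (2 * m + 2) * (pi - y)))" by simp
    ultimately show ?case by linarith
  qed simp
  show ?thesis
  proof (cases "even n")
    case True
    then show ?thesis using even_case y by (elim evenE) auto
  next
    case False
    then obtain m where m: "n = 2 * m + 1" by (elim oddE)
    have "real (2 * m) * y \<le> real n * y" using y m by (intro mult_right_mono) auto
    then have "?S (2 * m) \<ge> 0" using y by (intro even_case) linarith
    moreover have "sin (real n * (pi - y)) \<ge> 0"
      unfolding sin_mult_pi_minus using m y by (simp add: sin_ge_zero)
    then have "delta n * sin (real n * (pi - y)) \<ge> 0"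
      using pos_seq_delta m by (simp add: pos_seq_def less_imp_le)
    ultimately show ?thesis by (simp add: m)
  qed
qed

text \<open>Away from \<open>x = \<pi>\<close> on the scale \<open>1/n\<close>, the conjugate Dirichlet part and the Fejer-Jackson part are estimated
  separately; the possible loss \<open>\<bar>sin Nx\<bar> / (2N cos v)\<close> in the latter is absorbed by the quadratic
  gain \<open>(sin Nx)\<^sup>2 / (2 sin v)\<close> in the former.\<close>

lemma delta_sum_nonneg_bulk:
  assumes x: "0 < x" "x < pi" and n: "(real n + 1 / 2) * (pi - x) \<ge> pi"
  shows "(\<Sum>k=1..n. delta k * sin (real k * x)) \<ge> 0"
proof -
  define N where "N = real n + 1 / 2"
  define v where "v = x / 2"
  define s where "s = \<bar>sin (N * x)\<bar>"
  define c where "c = cos (N * x)"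
  have N: "N > 0" by (simp add: N_def)
  have v: "0 < v" "v < pi / 2" using x by (auto simp: v_def)
  have sv: "sin v > 0" using v by (intro sin_gt_zero) auto
  have cv: "cos v > 0" using v by (intro cos_gt_zero_pi) auto
  define A where "A = (\<Sum>k=1..n. sin (real k * x))"
  define F where "F = (\<Sum>k=1..n. - ((- 1) ^ k) / real k * sin (real k * x))"
  have split: "(\<Sum>k=1..n. delta k * sin (real k * x)) = 2 * A + F"
    unfolding A_def F_def sum_distrib_left sum.distrib[symmetric]
    by (intro sum.cong) (simp_all add: delta_def algebra_simps)
  have A: "2 * A = (cos v - c) / sin v"
    using sum_sin_closed_form[of x n] sv by (simp add: A_def v_def c_def N_def field_simps)
  have "cos (v / 2) > 0" using v by (intro cos_gt_zero_pi) auto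
  then have "tan (v / 2) = (1 - cos v) / sin v"
    using sin_mult_tan_half[of v] sv by (simp add: field_simps)
  then have A': "2 * A = - tan (v / 2) + (1 - c) / sin v"
    using A sv by (simp add: field_simps)
  have "s\<^sup>2 / 2 \<le> 1 - c"
  proof -
    have "s\<^sup>2 = (1 - c) * (1 + c)"
      by (simp add: s_def c_def sin_squared_eq power2_eq_square algebra_simps)
    also have "\<dots> \<le> (1 - c) * 2" by (intro mult_left_mono) (auto simp: c_def)
    finally show ?thesis by simp
  qed
  then have "s\<^sup>2 / 2 / sin v \<le> (1 - c) / sin v" using sv by (intro divide_right_mono) auto
  \<comment> \<open>Completing the square in \<open>s\<close>.\<close>
  moreover have "s / (2 * N * cos v) - sin v / (8 * N\<^sup>2 * (cos v)\<^sup>2) \<le> s\<^sup>2 / 2 / sin v"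
  proof -
    have "0 \<le> (s - sin v / (2 * N * cos v))\<^sup>2 / (2 * sin v)" using sv by simp
    also have "\<dots> = s\<^sup>2 / 2 / sin v - s / (2 * N * cos v) + sin v / (8 * N\<^sup>2 * (cos v)\<^sup>2)"
      using sv cv N by (simp add: field_simps power2_eq_square)
    finally show ?thesis by linarith
  qed
  moreover have "F \<ge> v - s / (2 * N * cos v) - (1 / cos v - 1) / (2 * N)"
    using alternating_sine_sum_ge[of x n] x by (simp add: F_def v_def s_def N_def)
  moreover have "tan (v / 2) + sin v / (8 * N\<^sup>2 * (cos v)\<^sup>2) + (1 / cos v - 1) / (2 * N) \<le> v"
    using margin_beats_error[OF v, of N] n by (simp add: v_def N_def)
  ultimately show ?thesis unfolding split A' by linarith
qed

lemma delta_sum_nonneg: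
  assumes x: "x \<in> {0..pi}"
  shows "(\<Sum>k=1..n. delta k * sin (real k * x)) \<ge> 0"
proof (cases "real n * (pi - x) \<le> pi")
  case True
  then show ?thesis using delta_sum_nonneg_near_pi[of "pi - x" n] x by simp
next
  case False
  then have "x < pi" using x by (cases "x = pi") auto
  moreover have "(real n + 1 / 2) * (pi - x) \<ge> pi"
  proof -
    have "pi \<le> real n * (pi - x)" using False by simp
    also have "\<dots> \<le> (real n + 1 / 2) * (pi - x)" using x by (intro mult_right_mono) auto
    finally show ?thesis .
  qed
  ultimately show ?thesis
    using delta_sum_nonneg_bulk[of x n] x by (cases "x = 0") auto
qed

theorem theorem2:
  "(\<forall>a. pos_seq a \<and> sine_conditions a \<longrightarrow> PS_on {0..pi} (\<lambda>k x. a k * sin (real k * x)))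
   \<and> maximal_seq sine_conditions delta"
proof (intro conjI allI impI)
  fix a
  assume a: "pos_seq a \<and> sine_conditions a"
  show "PS_on {0..pi} (\<lambda>k x. a k * sin (real k * x))"
    unfolding PS_on_def
  proof (intro allI impI ballI)
    fix n :: nat and x :: real
    assume n: "1 \<le> n" and x: "x \<in> {0..pi}"
    have delta_pos: "delta k > 0" if "k \<ge> 1" for k
      using pos_seq_delta that by (simp add: pos_seq_def)
    have "0 \<le> a n / delta n * (\<Sum>k=1..n. delta k * sin (real k * x))"
      using a n delta_pos[OF n] delta_sum_nonneg[OF x]
      by (simp add: pos_seq_def less_imp_le)
    also have "\<dots> \<le> (\<Sum>k=1..n. a k / delta k * (delta k * sin (real k * x)))"
      using a n delta_sum_nonneg[OF x] by (intro weighted_sum_ge antimono_on_quotient_delta) auto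
    also have "\<dots> = (\<Sum>k=1..n. a k * sin (real k * x))"
      using delta_pos by (intro sum.cong refl) force
    finally show "0 \<le> (\<Sum>k=1..n. a k * sin (real k * x))" .
  qed
next
  show "maximal_seq sine_conditions delta"
    unfolding maximal_seq_def seq_dominates_def
    using pos_seq_delta sine_conditions_delta antimono_on_quotient_delta by blast
qed

end
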